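(* Let $K\subset\mathbb{R}^2$ be a convex body with $o\in\operatorname{int}K$. For some linearly independent $u,v\in\partial K$ and linearly independent $u^*,v^*\in\partial K^*$, let the supporting lines to $K$ with exterior normals $u^*$ and $v^*$ intersect $K$, e.g., at $u$ and $v$, respectively, and intersect each other at $p\in\mathbb{R}^2$, where $[p,o]\cap[u,v]\ne\emptyset$. Furthermore, let the supporting lines to $K^*$ with exterior normals $u$ and $v$ intersect $K^*$, e.g., at $u^*$ and $v^*$, respectively, and intersect each other at $p^*\in\mathbb{R}^2$, where $[p^*,o]\cap[u^*,v^*]\ne\emptyset$. Let $C=K\cap[o,u,v,p]$ and $C^*=K^*\cap[o,u^*,v^*,p^*]$, and let $p=\lambda u+\mu v$ for $\lambda,\mu>0$. If $$|C|\cdot|C^*|\le(1+\varepsilon)\,|[o,u,v,p]|\cdot|[o,u^*,v^*]|$$ for a positive $\varepsilon<\min\{\lambda,\mu\}/(\lambda+\mu)$, then for $$\gamma:=3\,\frac{\lambda+\mu}{\min\{\lambda,\mu\}}\,\bigl(1+\sqrt{\lambda+\mu}\bigr)$$ we have either $$C\subset(1+\gamma\varepsilon)[o,u,v],$$ or $$(1+\gamma\varepsilon)^{-1}[o,u,v,p]\subset C,\quad\text{that is,}\quad C^*\subset(1+\gamma\varepsilon)[o,u^*,v^*].$$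
   Context: $o$ is the origin of $\mathbb{R}^2$, $\langle\cdot,\cdot\rangle$ the scalar product, $|\cdot|$ denotes area, $[x_1,\ldots,x_k]$ denotes the convex hull of $\{x_1,\ldots,x_k\}$. A convex body is a compact convex set with non-empty interior. For $o\in\operatorname{int}K$ the polar is $K^*=\{x\in\mathbb{R}^2:\ \langle x,y\rangle\le 1\ \text{for all } y\in K\}$. "Intersect $K$, e.g., at $u$" means that $u$ is one of the points of $K$ on the supporting line (the intersection may contain other points). Since $u^*\in\partial K^*$, the supporting line to $K$ with exterior normal $u^*$ is $\{x:\langle u^*,x\rangle=1\}$, and similarly for $v^*$, and for $u,v$ and $K^*$. The symbol $C^*$ denotes the set defined in the statement, not the polar of $C$. "Either ... or" is not exclusive; "that is" expresses that the two inclusions in the second alternative are equivalent. *)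

theory Defs
  imports "HOL-Analysis.Analysis"
begin

definition convex_body :: "(real^2) set \<Rightarrow> bool" where
  "convex_body K \<longleftrightarrow> compact K \<and> convex K \<and> interior K \<noteq> {}"

definition polar :: "(real^2) set \<Rightarrow> (real^2) set" where
  "polar K = {x. \<forall>y\<in>K. x \<bullet> y \<le> 1}"

(* The line with normal n on which the functional attains its supremum over K.  It is a genuine
   supporting line for n \<noteq> 0 and compact nonempty K; for n in the frontier of the polar of a
   convex body K with 0 in its interior it is {x. n \<bullet> x = 1}. *)
definition supp_line :: "(real^2) set \<Rightarrow> real^2 \<Rightarrow> (real^2) set" where
  "supp_line K n = {x. n \<bullet> x = (SUP y\<in>K. n \<bullet> y)}"

(* The inequality excludes the case where the set {x, y} collapses to a singleton. *)
definition lin_indep2 :: "real^2 \<Rightarrow> real^2 \<Rightarrow> bool" where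
  "lin_indep2 x y \<longleftrightarrow> x \<noteq> y \<and> independent {x, y}"

abbreviation area :: "(real^2) set \<Rightarrow> real" where
  "area S \<equiv> measure lebesgue S"

abbreviation dilate :: "real \<Rightarrow> (real^2) set \<Rightarrow> (real^2) set" where
  "dilate c S \<equiv> (\<lambda>x. c *\<^sub>R x) ` S"

end

theory Submission
  imports Defs
begin

text \<open>
  Write L = lam + mu, let k be the maximum of the functional ps over K, attained at x, and
  let h be the maximum of p over the polar.  At u and v the functionals ps and mu us + lam vs agree,
  so ps = mu us + lam vs, and the two sides of the duality have the same shape.  Since ps is 1 at u
  and v, it measures how far C sticks out of the triangle: C lies in c [0, u, v] as soon as k is at most c.  The functional p does
  the same for Cs.  By the bipolar theorem, p/c lies in K exactly if h is at most c, which yields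
  the equivalence of the two inclusions.  It remains to show that k - 1 and h - 1 cannot both exceed
  gamma epsilon.

  Measure areas relative to the triangles [0, u, v] and [0, us, vs].  As p/h lies in K and a
  maximiser y of p lies in the polar, the parts of K and of its polar in the two sectors have
  relative areas at least L/h and h (\<open>sector_areas\<close>), so their product is at least L, which is the
  value for both the triangle and the quadrilateral.  To gain more, cut K along the ray of x and the
  polar along the ray of the normal ps/k at x, apply this bound to both pieces, and add up; the two
  sums multiply to at least
    L + (lam mu / L) (k - 1) (h - 1) / (L - 1)
  (\<open>refined_area_product\<close>).  The gain arises because the sharp constant of a piece is
  1 + D a / (D + a) instead of 1, where D = k - 1 and a is 1 minus the value at x of the normal us or
  vs of that piece.  For the piece that contains p, this also controls h: there p is a non-negative
  combination of x and of u or v, at which no functional from the polar exceeds 1.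

  Finally k h is at least L, so one of k and h is at least the square root of L, and the area
  hypothesis bounds the other (\<open>no_two_large_gaps\<close>).
\<close>


section \<open>Planar linear algebra and areas of triangles at the origin\<close>

definition det2 :: "real^2 \<Rightarrow> real^2 \<Rightarrow> real" where
  "det2 x y = x $ 1 * y $ 2 - x $ 2 * y $ 1"

abbreviation tri :: "real^2 \<Rightarrow> real^2 \<Rightarrow> real" where
  "tri u v \<equiv> area (convex hull {0, u, v})"

lemma lin_indep2_imp_det2:
  assumes "lin_indep2 x y"
  shows "det2 x y \<noteq> 0"
proof
  assume d: "det2 x y = 0"
  have ind: "independent {x, y}" and ne: "x \<noteq> y"
    using assms by (auto simp: lin_indep2_def)
  then have y: "y \<notin> span {x}" and x0: "x \<noteq> 0"
    using independent_insert[of y "{x}"] dependent_zero[of "{x, y}"]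
    by (auto simp: insert_commute)
  have "\<exists>c. y = c *\<^sub>R x"
  proof (cases "x $ 1 = 0")
    case True
    then have "x $ 2 \<noteq> 0"
      using x0 by (auto simp: vec_eq_iff forall_2)
    moreover have "y $ 1 = 0"
      using d True \<open>x $ 2 \<noteq> 0\<close> by (simp add: det2_def)
    ultimately show ?thesis
      using True by (intro exI[of _ "y $ 2 / x $ 2"]) (simp add: vec_eq_iff forall_2)
  next
    case False
    then show ?thesis
      using d by (intro exI[of _ "y $ 1 / x $ 1"])
        (simp add: vec_eq_iff forall_2 det2_def field_simps)
  qed
  then show False
    using y span_base[of x "{x}"] span_scale by blast
qed

lemma det2_coordinates:
  assumes "det2 u v \<noteq> 0"
  obtains s t where "x = s *\<^sub>R u + t *\<^sub>R v"
proof
  have "det2 u v *\<^sub>R x = det2 x v *\<^sub>R u + det2 u x *\<^sub>R v"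
    by (simp add: vec_eq_iff forall_2 det2_def algebra_simps)
  then have "(1 / det2 u v) *\<^sub>R (det2 u v *\<^sub>R x)
      = (1 / det2 u v) *\<^sub>R (det2 x v *\<^sub>R u + det2 u x *\<^sub>R v)"
    by simp
  then show "x = (det2 x v / det2 u v) *\<^sub>R u + (det2 u x / det2 u v) *\<^sub>R v"
    using assms by (simp add: scaleR_add_right)
qed

lemma eq_if_inner_eq_basis:
  assumes "det2 u v \<noteq> 0" "x \<bullet> u = y \<bullet> u" "x \<bullet> v = y \<bullet> v"
  shows "x = y"
proof -
  obtain s t where "x - y = s *\<^sub>R u + t *\<^sub>R v"
    using det2_coordinates[OF assms(1)] by blast
  then have "(x - y) \<bullet> (x - y) = s * ((x - y) \<bullet> u) + t * ((x - y) \<bullet> v)"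
    by (metis inner_add_right inner_scaleR_right)
  also have "\<dots> = 0"
    using assms(2,3) by (simp add: inner_diff_left)
  finally show ?thesis
    by simp
qed

lemma tri_eq_det2: "tri u v = \<bar>det2 u v\<bar> / 2"
proof -
  have "tri u v = measure lborel (convex hull {0, u, v})"
    by (simp add: compact_imp_closed finite_imp_compact_convex_hull)
  also have "\<dots> = \<bar>det2 u v\<bar> / 2"
    unfolding content_triangle by (simp add: det2_def abs_minus_commute algebra_simps)
  finally show ?thesis .
qed

lemma tri_combination_right: "tri u (s *\<^sub>R u + t *\<^sub>R v) = \<bar>t\<bar> * tri u v"
proof -
  have "det2 u (s *\<^sub>R u + t *\<^sub>R v) = t * det2 u v"
    by (simp add: det2_def algebra_simps)
  then show ?thesis
    by (simp add: tri_eq_det2 abs_mult)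
qed

lemma tri_combination_left: "tri (s *\<^sub>R u + t *\<^sub>R v) v = \<bar>s\<bar> * tri u v"
proof -
  have "det2 (s *\<^sub>R u + t *\<^sub>R v) v = s * det2 u v"
    by (simp add: det2_def algebra_simps)
  then show ?thesis
    by (simp add: tri_eq_det2 abs_mult)
qed

lemma triangle_eq:
  "convex hull {0, u, v} = {s *\<^sub>R u + t *\<^sub>R v | s t. 0 \<le> s \<and> 0 \<le> t \<and> s + t \<le> 1}"
proof (intro equalityI subsetI)
  fix x assume "x \<in> convex hull {0, u, v}"
  then show "x \<in> {s *\<^sub>R u + t *\<^sub>R v | s t. 0 \<le> s \<and> 0 \<le> t \<and> s + t \<le> 1}"
    unfolding convex_hull_3
    by (smt (verit, ccfv_threshold) add_0_left mem_Collect_eq scaleR_zero_right)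
next
  fix x assume "x \<in> {s *\<^sub>R u + t *\<^sub>R v | s t. 0 \<le> s \<and> 0 \<le> t \<and> s + t \<le> 1}"
  then obtain s t where st: "x = s *\<^sub>R u + t *\<^sub>R v" "0 \<le> s" "0 \<le> t" "s + t \<le> 1"
    by blast
  then show "x \<in> convex hull {0, u, v}"
    unfolding convex_hull_3
    by (intro CollectI exI[of _ "1 - s - t"] exI[of _ s] exI[of _ t]) auto
qed

lemma mem_triangle:
  "0 \<le> s \<Longrightarrow> 0 \<le> t \<Longrightarrow> s + t \<le> 1 \<Longrightarrow> s *\<^sub>R u + t *\<^sub>R v \<in> convex hull {0, u, v}"
  unfolding triangle_eq by blast


section \<open>Sectors\<close>

definition sector :: "real^2 \<Rightarrow> real^2 \<Rightarrow> (real^2) set" where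
  "sector u v = {s *\<^sub>R u + t *\<^sub>R v | s t. 0 \<le> s \<and> 0 \<le> t}"

lemma mem_sector: "0 \<le> s \<Longrightarrow> 0 \<le> t \<Longrightarrow> s *\<^sub>R u + t *\<^sub>R v \<in> sector u v"
  by (auto simp: sector_def)

lemma sector_generators: "u \<in> sector u v" "v \<in> sector u v" "0 \<in> sector u v"
  using mem_sector[of 1 0 u v] mem_sector[of 0 1 u v] mem_sector[of 0 0 u v] by auto

lemma sector_add:
  assumes "x \<in> sector u v" "y \<in> sector u v"
  shows "x + y \<in> sector u v"
proof -
  obtain s t s' t' where "x = s *\<^sub>R u + t *\<^sub>R v" "0 \<le> s" "0 \<le> t"
      "y = s' *\<^sub>R u + t' *\<^sub>R v" "0 \<le> s'" "0 \<le> t'"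
    using assms by (auto simp: sector_def)
  moreover from this have "x + y = (s + s') *\<^sub>R u + (t + t') *\<^sub>R v"
    by (simp add: algebra_simps)
  ultimately show ?thesis
    using mem_sector[of "s + s'" "t + t'"] by simp
qed

lemma sector_scale:
  assumes "x \<in> sector u v" "0 \<le> c"
  shows "c *\<^sub>R x \<in> sector u v"
proof -
  obtain s t where "x = s *\<^sub>R u + t *\<^sub>R v" "0 \<le> s" "0 \<le> t"
    using assms by (auto simp: sector_def)
  then have "c *\<^sub>R x = (c * s) *\<^sub>R u + (c * t) *\<^sub>R v" "0 \<le> c * s" "0 \<le> c * t"
    using assms by (auto simp: algebra_simps)
  then show ?thesis
    using mem_sector[of "c * s" "c * t" u v] by simp
qed

lemma convex_sector: "convex (sector u v)"
  by (auto simp: convex_def intro!: sector_add sector_scale)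

lemma sector_mono:
  assumes "x \<in> sector u v" "y \<in> sector u v"
  shows "sector x y \<subseteq> sector u v"
  using assms by (auto simp: sector_def[of x y] intro!: sector_add sector_scale)

lemma sector_commute: "sector u v = sector v u"
  by (intro equalityI sector_mono sector_generators)

lemma convex_Int_sector_lmeasurable:
  assumes "convex K" "bounded K"
  shows "K \<inter> sector u v \<in> lmeasurable"
  using assms by (intro measurable_convex convex_Int convex_sector bounded_Int) auto

lemma tri_le_area_sector:
  assumes "convex K" "bounded K" "0 \<in> K" "u \<in> K" "v \<in> K"
  shows "tri u v \<le> area (K \<inter> sector u v)"
proof (rule measure_mono_fmeasurable)
  show "convex hull {0, u, v} \<subseteq> K \<inter> sector u v"
    using assms by (intro hull_minimal convex_Int convex_sector) (auto intro: sector_generators)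
  show "convex hull {0, u, v} \<in> sets lebesgue"
    by (simp add: lmeasurable_compact fmeasurableD finite_imp_compact_convex_hull)
qed (use assms convex_Int_sector_lmeasurable in auto)

text \<open>A ray inside a sector cuts it into two sectors whose overlap lies on the line of the ray:
  if a vector is written with non-negative coefficients both over u and x and over x and v, then
  comparing its u- and v-components leaves only multiples of x.\<close>

lemma area_sector_split:
  assumes K: "convex K" "bounded K" and d: "det2 u v \<noteq> 0" and x: "x \<in> sector u v"
  shows "area (K \<inter> sector u x) + area (K \<inter> sector x v) \<le> area (K \<inter> sector u v)"
proof -
  let ?A = "K \<inter> sector u x" and ?B = "K \<inter> sector x v"
  obtain s t where st: "x = s *\<^sub>R u + t *\<^sub>R v" "0 \<le> s" "0 \<le> t"
    using x by (auto simp: sector_def)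
  have m: "?A \<in> lmeasurable" "?B \<in> lmeasurable"
    using K by (auto intro: convex_Int_sector_lmeasurable)
  have "?A \<inter> ?B \<subseteq> span {x}"
  proof
    fix z assume "z \<in> ?A \<inter> ?B"
    then have "z \<in> sector u x" "z \<in> sector x v"
      by auto
    then obtain a b c e where z: "z = a *\<^sub>R u + b *\<^sub>R x" "0 \<le> a" "0 \<le> b"
        "z = c *\<^sub>R x + e *\<^sub>R v" "0 \<le> c" "0 \<le> e"
      unfolding sector_def by blast
    have eq: "(a + b * s - c * s) *\<^sub>R u + (b * t - c * t - e) *\<^sub>R v = 0"
      using z(1,4) st(1) by (simp add: algebra_simps)
    have lin: "det2 ((a + b * s - c * s) *\<^sub>R u + (b * t - c * t - e) *\<^sub>R v) v
            = (a + b * s - c * s) * det2 u v"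
         "det2 u ((a + b * s - c * s) *\<^sub>R u + (b * t - c * t - e) *\<^sub>R v)
            = (b * t - c * t - e) * det2 u v"
      by (simp_all add: det2_def algebra_simps)
    have "a + b * s - c * s = 0" "b * t - c * t - e = 0"
      using lin d unfolding eq by (auto simp: det2_def)
    then have "a = (c - b) * s" "e = (b - c) * t"
      by (simp_all add: algebra_simps)
    then have "a = 0 \<or> e = 0"
      using z st by (smt (verit) mult_nonneg_nonneg mult_nonpos_nonneg)
    then have "z = b *\<^sub>R x \<or> z = c *\<^sub>R x"
      using z(1,4) by auto
    then show "z \<in> span {x}"
      using span_scale[OF span_base[of x "{x}"]] by auto
  qed
  moreover have "dim (span {x}) < DIM(real^2)"
    using dim_le_card'[of "{x}"] by simp
  ultimately have "negligible (?A \<inter> ?B)"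
    using negligible_lowdim negligible_subset by blast
  then have "area (?A \<union> ?B) = area ?A + area ?B"
    using measure_Un3[OF m] negligible_imp_measure0 by fastforce
  moreover have "area (?A \<union> ?B) \<le> area (K \<inter> sector u v)"
  proof (rule measure_mono_fmeasurable)
    show "?A \<union> ?B \<subseteq> K \<inter> sector u v"
      using sector_mono[of u u v x] sector_mono[of x u v v] x sector_generators by blast
    show "?A \<union> ?B \<in> sets lebesgue"
      using m by auto
  qed (use K convex_Int_sector_lmeasurable in auto)
  ultimately show ?thesis
    by simp
qed

lemma coordinate_sum_le_area_sector:
  assumes K: "convex K" "bounded K" "0 \<in> K" "u \<in> K" "v \<in> K" and d: "det2 u v \<noteq> 0"
    and x: "s *\<^sub>R u + t *\<^sub>R v \<in> K" "0 \<le> s" "0 \<le> t"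
  shows "(s + t) * tri u v \<le> area (K \<inter> sector u v)"
proof -
  let ?x = "s *\<^sub>R u + t *\<^sub>R v"
  have "(s + t) * tri u v = tri u ?x + tri ?x v"
    using x tri_combination_left[of s u t v] tri_combination_right[of u s t v]
    by (simp add: algebra_simps)
  also have "\<dots> \<le> area (K \<inter> sector u ?x) + area (K \<inter> sector ?x v)"
    using K x by (intro add_mono tri_le_area_sector)
  also have "\<dots> \<le> area (K \<inter> sector u v)"
    using K d x by (intro area_sector_split mem_sector)
  finally show ?thesis .
qed

text \<open>A point of the sector is a non-negative combination of p and of that one of u and v which is
  on its side of the diagonal through p; the sum of these two coefficients is then the value of us
  or vs at the point, because us is 1 at u and p, and vs is 1 at v and p.\<close>

lemma quadrilateral_eq:
  assumes n: "us \<bullet> u = 1" "vs \<bullet> v = 1" "us \<bullet> v \<le> 1" "vs \<bullet> u \<le> 1"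
    and p: "us \<bullet> p = 1" "vs \<bullet> p = 1" "p = lam *\<^sub>R u + mu *\<^sub>R v" "0 < lam" "0 < mu"
  shows "convex hull {0, u, v, p} = {x \<in> sector u v. us \<bullet> x \<le> 1 \<and> vs \<bullet> x \<le> 1}"
    and "convex hull {0, u, v, p} = convex hull {0, u, p} \<union> convex hull {0, p, v}"
proof -
  let ?Q = "{x \<in> sector u v. us \<bullet> x \<le> 1 \<and> vs \<bullet> x \<le> 1}"
  let ?T = "convex hull {0, u, p} \<union> convex hull {0, p, v}"
  have "convex ?Q"
  proof -
    have "?Q = sector u v \<inter> {x. us \<bullet> x \<le> 1} \<inter> {x. vs \<bullet> x \<le> 1}"
      by auto
    then show ?thesis
      by (simp add: convex_Int convex_sector convex_halfspace_le)
  qed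
  then have "convex hull {0, u, v, p} \<subseteq> ?Q"
    using n p sector_generators[where u = u and v = v] mem_sector[of lam mu u v]
    by (intro hull_minimal) auto
  moreover have "?Q \<subseteq> ?T"
  proof
    fix x assume "x \<in> ?Q"
    then obtain s t where x: "x = s *\<^sub>R u + t *\<^sub>R v" "0 \<le> s" "0 \<le> t" "us \<bullet> x \<le> 1" "vs \<bullet> x \<le> 1"
      by (auto simp: sector_def)
    have a: "1 - lam = mu * (us \<bullet> v)" and b: "1 - mu = lam * (vs \<bullet> u)"
      using p n by (auto simp: inner_add_right)
    have le: "s + t * (us \<bullet> v) \<le> 1" "s * (vs \<bullet> u) + t \<le> 1"
      using x n by (auto simp: inner_add_right)
    show "x \<in> ?T"
    proof (cases "t * lam \<le> s * mu")
      case True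
      have "x = (s - t * lam / mu) *\<^sub>R u + (t / mu) *\<^sub>R p"
        using x p by (simp add: algebra_simps)
      moreover have "s - t * lam / mu + t / mu = s + t * (us \<bullet> v)"
      proof -
        have "(t - t * lam) / mu = t * (us \<bullet> v)"
          using p by (simp add: right_diff_distrib[of t 1 lam, simplified, symmetric] a)
        then show ?thesis
          by (simp add: diff_divide_distrib)
      qed
      moreover have "0 \<le> s - t * lam / mu" "0 \<le> t / mu"
        using True x p by (auto simp: field_simps)
      ultimately show ?thesis
        using le(1) by (metis UnI1 mem_triangle)
    next
      case False
      have "x = (s / lam) *\<^sub>R p + (t - s * mu / lam) *\<^sub>R v"
        using x p by (simp add: algebra_simps)
      moreover have "s / lam + (t - s * mu / lam) = s * (vs \<bullet> u) + t"
      proof -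
        have "(s - s * mu) / lam = s * (vs \<bullet> u)"
          using p by (simp add: right_diff_distrib[of s 1 mu, simplified, symmetric] b)
        then show ?thesis
          by (simp add: diff_divide_distrib)
      qed
      moreover have "0 \<le> t - s * mu / lam" "0 \<le> s / lam"
        using False x p by (auto simp: field_simps)
      ultimately show ?thesis
        using le(2) by (metis UnI2 mem_triangle)
    qed
  qed
  moreover have "?T \<subseteq> convex hull {0, u, v, p}"
    by (intro Un_least hull_mono) auto
  ultimately show "convex hull {0, u, v, p} = ?Q" "convex hull {0, u, v, p} = ?T"
    by auto
qed

section \<open>Polar bodies and flags\<close>

lemma polar_inner_le: "y \<in> polar K \<Longrightarrow> x \<in> K \<Longrightarrow> y \<bullet> x \<le> 1"
  by (simp add: polar_def)

lemma zero_in_polar: "0 \<in> polar K"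
  by (simp add: polar_def)

lemma polar_eq_Inter: "polar K = (\<Inter>y\<in>K. {x. x \<bullet> y \<le> 1})"
  by (auto simp: polar_def)

lemma convex_polar: "convex (polar K)"
  unfolding polar_eq_Inter
  by (intro convex_INT) (simp add: convex_halfspace_le inner_commute)

lemma closed_polar: "closed (polar K)"
  unfolding polar_eq_Inter
  by (intro closed_INT ballI closed_Collect_le continuous_intros)

lemma bounded_polar:
  assumes "0 \<in> interior K"
  shows "bounded (polar K)"
proof -
  obtain r where r: "0 < r" "cball 0 r \<subseteq> K"
    using assms by (auto simp: mem_interior_cball)
  have "norm y \<le> 1 / r" if "y \<in> polar K" for y
  proof (cases "y = 0")
    case False
    have "(r / norm y) *\<^sub>R y \<in> K"
      using r False by (intro subsetD[OF r(2)]) simp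
    then have "y \<bullet> ((r / norm y) *\<^sub>R y) \<le> 1"
      using that polar_inner_le by blast
    then have "r * norm y \<le> 1"
      using False by (simp add: dot_square_norm power2_eq_square)
    then show ?thesis
      using r by (simp add: field_simps)
  qed (use r in auto)
  then show ?thesis
    using boundedI by blast
qed

lemma compact_polar: "0 \<in> interior K \<Longrightarrow> compact (polar K)"
  using bounded_polar closed_polar compact_eq_bounded_closed by blast

text \<open>The non-trivial half of the bipolar theorem, by separating a point from the body.\<close>

lemma scaled_mem_if_polar_bound:
  assumes "convex K" "closed K" "0 \<in> K" and h: "0 < h" "\<And>y. y \<in> polar K \<Longrightarrow> y \<bullet> p \<le> h"
  shows "(1 / h) *\<^sub>R p \<in> K"
proof (rule ccontr)
  assume "(1 / h) *\<^sub>R p \<notin> K"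
  then obtain a b where ab: "a \<bullet> ((1 / h) *\<^sub>R p) < b" "\<And>x. x \<in> K \<Longrightarrow> b < a \<bullet> x"
    using separating_hyperplane_closed_point assms by metis
  have b: "b < 0"
    using ab(2)[of 0] assms by simp
  have "(1 / b) *\<^sub>R a \<in> polar K"
    unfolding polar_def using ab(2) b by (auto simp: divide_simps less_imp_le)
  then have "((1 / b) *\<^sub>R a) \<bullet> p \<le> h"
    using h by blast
  moreover have "(a \<bullet> p) / h < b"
    using ab(1) by simp
  ultimately show False
    using b h by (simp add: field_simps)
qed

text \<open>A boundary point of a body together with a normal of a supporting line there, normalised
  to take the value 1 on that line; equivalently, a pair of dual boundary points.\<close>

definition flag :: "(real^2) set \<Rightarrow> real^2 \<Rightarrow> real^2 \<Rightarrow> bool" where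
  "flag K x n \<longleftrightarrow> x \<in> K \<and> n \<in> polar K \<and> n \<bullet> x = 1"

lemma flagD:
  assumes "flag K x n"
  shows "x \<in> K" "n \<in> polar K" "n \<bullet> x = 1"
  using assms by (auto simp: flag_def)

text \<open>A normal in the boundary of the polar has supremum 1 on the body: were the supremum
  smaller, every normal close to this one would still lie in the polar.\<close>

lemma flag_if_on_supp_line:
  assumes "compact K" and n: "n \<in> frontier (polar K)" and x: "x \<in> K \<inter> supp_line K n"
  shows "flag K x n"
proof -
  have nP: "n \<in> polar K"
    using n closed_polar frontier_subset_closed by blast
  then have le: "n \<bullet> x \<le> 1"
    using x polar_inner_le by blast
  have "n \<bullet> x = 1"
  proof (rule ccontr)
    assume "n \<bullet> x \<noteq> 1"
    with le have lt: "n \<bullet> x < 1"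
      by simp
    have bdd: "bdd_above ((\<lambda>y. n \<bullet> y) ` K)"
      using nP by (auto simp: bdd_above_def intro!: exI[of _ 1] polar_inner_le)
    have max: "n \<bullet> y \<le> n \<bullet> x" if "y \<in> K" for y
      using x that cSUP_upper[OF that bdd] by (simp add: supp_line_def)
    obtain B where B: "0 < B" "\<And>y. y \<in> K \<Longrightarrow> norm y \<le> B"
      using compact_imp_bounded[OF assms(1)] by (auto simp: bounded_pos)
    let ?r = "(1 - n \<bullet> x) / B"
    have "ball n ?r \<subseteq> polar K"
    proof
      fix m assume "m \<in> ball n ?r"
      then have m: "norm (m - n) < ?r"
        by (simp add: dist_norm norm_minus_commute)
      have "m \<bullet> y \<le> 1" if "y \<in> K" for y
      proof -
        have "(m - n) \<bullet> y \<le> norm (m - n) * norm y"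
          by (rule norm_cauchy_schwarz)
        also have "\<dots> \<le> ?r * B"
          using m B(2)[OF that] lt B(1) by (intro mult_mono) auto
        also have "\<dots> = 1 - n \<bullet> x"
          using B by simp
        finally show ?thesis
          using max[OF that] by (simp add: inner_diff_left)
      qed
      then show "m \<in> polar K"
        by (simp add: polar_def)
    qed
    moreover have "0 < ?r"
      using lt B by simp
    ultimately have "n \<in> interior (polar K)"
      by (auto simp: mem_interior)
    then show False
      using n by (simp add: frontier_def)
  qed
  then show ?thesis
    using nP x by (simp add: flag_def)
qed

text \<open>A functional y that exceeds 1 at the intersection p of two supporting lines but not at the
  points of contact u and v is a non-negative combination of the normals us and vs: with
  a negative coefficient on one normal, its value at p would be at most its value at the point of
  contact of the other.  Body and polar play symmetric roles here.\<close>

lemma peak_in_sector: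
  assumes n: "us \<bullet> u = 1" "vs \<bullet> v = 1" "us \<bullet> v \<le> 1" "vs \<bullet> u \<le> 1" and d: "det2 us vs \<noteq> 0"
    and p: "us \<bullet> p = 1" "vs \<bullet> p = 1" and y: "y \<bullet> u \<le> 1" "y \<bullet> v \<le> 1" "1 < y \<bullet> p"
  shows "y \<in> sector us vs"
proof -
  obtain s t where st: "y = s *\<^sub>R us + t *\<^sub>R vs"
    using det2_coordinates[OF d] by blast
  have 1: "s + t > 1" "s + t * (vs \<bullet> u) \<le> 1" "s * (us \<bullet> v) + t \<le> 1"
    using y n p by (auto simp: st inner_add_left)
  have "0 \<le> s"
  proof (rule ccontr)
    assume "\<not> 0 \<le> s"
    then have "s * 1 \<le> s * (us \<bullet> v)"
      using n by (intro mult_left_mono_neg) auto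
    then show False
      using 1 by simp
  qed
  moreover have "0 \<le> t"
  proof (rule ccontr)
    assume "\<not> 0 \<le> t"
    then have "t * 1 \<le> t * (vs \<bullet> u)"
      using n by (intro mult_left_mono_neg) auto
    then show False
      using 1 by simp
  qed
  ultimately show ?thesis
    using mem_sector st by blast
qed

section \<open>Area products over a sector\<close>

text \<open>Let h be the maximum over the polar of the functional p.  Then p/h lies in K by the bipolar
  theorem and spans with u and v a quadrilateral of relative area (lam + mu)/h, while
  a maximiser spans with us and vs one of relative area h in the polar.  Multiplying
  the two bounds gives a sharp lower bound for the area product; keeping them apart, with the same
  h, is what the refinement below needs.\<close>

lemma sector_areas:
  assumes K: "convex K" "compact K" "0 \<in> interior K"
    and fl: "flag K u us" "flag K v vs" and d: "det2 u v \<noteq> 0" "det2 us vs \<noteq> 0"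
    and p: "us \<bullet> p = 1" "vs \<bullet> p = 1" "p = lam *\<^sub>R u + mu *\<^sub>R v" "0 \<le> lam" "0 \<le> mu"
  obtains h where "1 \<le> h" "h \<le> lam + mu"
    "(lam + mu) / h * tri u v \<le> area (K \<inter> sector u v)"
    "h * tri us vs \<le> area (polar K \<inter> sector us vs)"
proof -
  note f = flagD[OF fl(1)] flagD[OF fl(2)]
  have K0: "0 \<in> K" "bounded K" "closed K"
    using K interior_subset compact_imp_bounded compact_imp_closed by auto
  have "continuous_on (polar K) (\<lambda>y. y \<bullet> p)"
    by (intro continuous_intros)
  then obtain y where y: "y \<in> polar K" "\<And>z. z \<in> polar K \<Longrightarrow> z \<bullet> p \<le> y \<bullet> p"
    using continuous_attains_sup[OF compact_polar[OF K(3)]] f(2) by (metis empty_iff)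
  define h where "h = y \<bullet> p"
  have h1: "1 \<le> h"
    using y(2)[OF f(2)] p by (simp add: h_def)
  have "h = lam * (y \<bullet> u) + mu * (y \<bullet> v)"
    using p by (simp add: h_def inner_add_right)
  also have "\<dots> \<le> lam * 1 + mu * 1"
    using p f y polar_inner_le by (intro add_mono mult_left_mono) auto
  finally have h2: "h \<le> lam + mu"
    by simp
  have "(1 / h) *\<^sub>R p \<in> K"
    using K K0 h1 y by (intro scaled_mem_if_polar_bound) (auto simp: h_def)
  then have "(lam / h) *\<^sub>R u + (mu / h) *\<^sub>R v \<in> K"
    using p by (simp add: scaleR_add_right)
  then have "(lam / h + mu / h) * tri u v \<le> area (K \<inter> sector u v)"
    using K K0 f p d h1 by (intro coordinate_sum_le_area_sector) auto
  moreover have "h * tri us vs \<le> area (polar K \<inter> sector us vs)"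
  proof -
    \<comment> \<open>If the maximum is 1, then it is attained at us, which trivially lies in the sector.\<close>
    obtain z where z: "z \<in> polar K" "z \<in> sector us vs" "z \<bullet> p = h"
    proof (cases "h = 1")
      case True
      then show ?thesis
        using that[of us] f p sector_generators by auto
    next
      case False
      then have "y \<in> sector us vs"
        using f p(1,2) d y(1) h1
        by (intro peak_in_sector[of us u vs v p]) (auto simp: h_def intro: polar_inner_le)
      then show ?thesis
        using that y by (simp add: h_def)
    qed
    then obtain s t where st: "z = s *\<^sub>R us + t *\<^sub>R vs" "0 \<le> s" "0 \<le> t"
      by (auto simp: sector_def)
    have "s + t = h"
      using z(3) st p by (simp add: inner_add_left)
    moreover have "(s + t) * tri us vs \<le> area (polar K \<inter> sector us vs)"
      using z st d f K convex_polar bounded_polar zero_in_polar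
      by (intro coordinate_sum_le_area_sector) auto
    ultimately show ?thesis
      by simp
  qed
  ultimately show ?thesis
    using that[of h] h1 h2 by (simp add: add_divide_distrib)
qed

text \<open>The arithmetic of gluing two adjacent sectors.  Here t, s are the relative areas of the
  two triangles, lam, mu are proportional to those of the dual triangles, and 1 + e1, 1 + e2 the sharp products for the
  two sectors.  Of the two mixed terms of the product, one is at least what it would be
  if the area ratios of the sectors agreed, and for the other the trivial bound suffices; which
  is which depends on the sector with the larger area ratio.\<close>

lemma glued_product_bound:
  fixes s t lam mu e1 e2 h1 h2 :: real
  assumes pos: "0 < s" "0 < t" "0 < lam" "0 < mu" "0 \<le> e1" "0 \<le> e2"
    and h: "1 \<le> h1" "h1 \<le> 1 + e1" "1 \<le> h2" "h2 \<le> 1 + e2" and le: "lam * t \<le> mu * s"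
  shows "(s + t) * (lam + mu + lam * mu / (lam + mu) * e2)
    \<le> (t * ((1 + e1) / h1) + s * ((1 + e2) / h2)) * (lam * h1 + mu * h2)"
proof -
  define X where "X = (1 + e1) * h2 / h1"
  define Y where "Y = (1 + e2) * h1 / h2"
  have X1: "1 \<le> X"
    unfolding X_def using h pos mult_mono[of h1 "1 + e1" 1 h2] by (simp add: field_simps)
  have Y1: "1 \<le> Y"
    unfolding Y_def using h pos mult_mono[of h2 "1 + e2" 1 h1] by (simp add: field_simps)
  have e: "(t * ((1 + e1) / h1) + s * ((1 + e2) / h2)) * (lam * h1 + mu * h2)
      = t * lam * (1 + e1) + s * mu * (1 + e2) + t * mu * X + s * lam * Y"
    using h by (simp add: X_def Y_def field_simps)
  have sm: "lam * mu / (lam + mu) \<le> mu"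
    using pos by (simp add: field_simps)
  show ?thesis
  proof (cases "(1 + e2) * h1 \<le> (1 + e1) * h2")
    case True
    then have "1 + e2 \<le> X"
      unfolding X_def using h by (simp add: field_simps)
    then have "t * mu * (1 + e2) + s * lam * 1 \<le> t * mu * X + s * lam * Y"
      using pos Y1 by (intro add_mono mult_left_mono) auto
    moreover have "(s + t) * (lam * mu / (lam + mu) * e2) \<le> (s + t) * (mu * e2)"
      using sm pos by (intro mult_left_mono mult_right_mono) auto
    moreover have "0 \<le> t * lam * e1"
      using pos by simp
    ultimately show ?thesis
      unfolding e by (simp add: algebra_simps)
  next
    case False
    then have "1 + e1 \<le> Y"
      unfolding Y_def using h by (simp add: field_simps)
    then have "t * mu * 1 + s * lam * (1 + e1) \<le> t * mu * X + s * lam * Y"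
      using pos X1 by (intro add_mono mult_left_mono) auto
    moreover have "(s + t) * (lam * mu / (lam + mu) * e2) \<le> s * mu * e2"
    proof -
      have "(s + t) * lam / (lam + mu) \<le> s"
        using pos le by (simp add: field_simps)
      then have "((s + t) * lam / (lam + mu)) * (mu * e2) \<le> s * (mu * e2)"
        using pos by (intro mult_right_mono) auto
      then show ?thesis
        by (simp add: mult_ac)
    qed
    moreover have "0 \<le> s * lam * e1" "0 \<le> t * lam * e1"
      using pos by auto
    ultimately show ?thesis
      unfolding e by (simp add: algebra_simps)
  qed
qed

text \<open>Cut the sector of K along a maximiser x of ps, and the polar sector along the normal q = ps/k
  of the supporting line at x.  The bounds of \<open>sector_areas\<close> for the pieces (u, x) and (x, v) have
  sharp constants 1 + e1 and 1 + e2.  The assumption on s and t says that p lies in the sector of x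
  and v.  There e2 dominates the gain (k - 1) (y p - 1) / (lam + mu - 1) for every functional y in
  the polar, since y is at most 1 at x and v and p is a non-negative combination of them.\<close>

lemma refined_area_product_oriented:
  assumes K: "convex K" "compact K" "0 \<in> interior K"
    and fl: "flag K u us" "flag K v vs" and d: "det2 u v \<noteq> 0" "det2 us vs \<noteq> 0"
    and p: "us \<bullet> p = 1" "vs \<bullet> p = 1" "p = lam *\<^sub>R u + mu *\<^sub>R v"
    and pos: "0 < lam" "0 < mu" "1 < lam + mu"
    and ps: "ps \<bullet> u = 1" "ps \<bullet> v = 1" "ps = mu *\<^sub>R us + lam *\<^sub>R vs"
    and x: "x \<in> K" "\<And>z. z \<in> K \<Longrightarrow> ps \<bullet> z \<le> ps \<bullet> x" "1 < ps \<bullet> x"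
    and y: "y \<in> polar K"
    and xst: "x = s *\<^sub>R u + t *\<^sub>R v" "lam * t \<le> mu * s"
  shows "(lam + mu + lam * mu / (lam + mu) * ((ps \<bullet> x - 1) * (y \<bullet> p - 1) / (lam + mu - 1)))
      * (tri u v * tri us vs)
    \<le> area (K \<inter> sector u v) * area (polar K \<inter> sector us vs)"
proof -
  note f = flagD[OF fl(1)] flagD[OF fl(2)]
  define k where "k = ps \<bullet> x"
  define D where "D = k - 1"
  define q where "q = (1 / k) *\<^sub>R ps"
  define \<alpha> where "\<alpha> = 1 - us \<bullet> x"
  define \<beta> where "\<beta> = 1 - vs \<bullet> x"
  have k: "1 < k" and D: "0 < D" and kD: "k = 1 + D"
    using x by (auto simp: k_def D_def)
  have kst: "k = s + t"
    using xst ps by (simp add: k_def inner_add_right)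
  then have D_eq: "D = s + t - 1"
    by (simp add: D_def)
  have \<alpha>: "0 \<le> \<alpha>" and \<beta>: "0 \<le> \<beta>"
    using polar_inner_le x f by (auto simp: \<alpha>_def \<beta>_def)
  have ab: "lam + mu * (us \<bullet> v) = 1" "lam * (vs \<bullet> u) + mu = 1"
    using p f by (auto simp: inner_add_right)
  \<comment> \<open>Both coordinates of the maximiser are positive, so that both sectors are proper.\<close>
  have t_eq: "t * (lam + mu - 1) = mu * (D + \<alpha>)"
  proof -
    have "mu * \<alpha> = mu - mu * s - t * (mu * (us \<bullet> v))"
      using f by (simp add: \<alpha>_def xst(1) inner_add_right algebra_simps)
    also have "mu * (us \<bullet> v) = 1 - lam"
      using ab by simp
    finally show ?thesis
      by (simp add: D_eq algebra_simps)
  qed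
  have s_eq: "s * (lam + mu - 1) = lam * (D + \<beta>)"
  proof -
    have "lam * \<beta> = lam - lam * t - s * (lam * (vs \<bullet> u))"
      using f by (simp add: \<beta>_def xst(1) inner_add_right algebra_simps)
    also have "lam * (vs \<bullet> u) = 1 - mu"
      using ab by simp
    finally show ?thesis
      by (simp add: D_eq algebra_simps)
  qed
  have "0 < t * (lam + mu - 1)" "0 < s * (lam + mu - 1)"
    using t_eq s_eq pos D \<alpha> \<beta> by auto
  then have st: "0 < s" "0 < t"
    using pos by (auto simp: zero_less_mult_iff)
  have qP: "q \<in> polar K"
    using x k by (auto simp: polar_def q_def k_def)
  have flx: "flag K x q"
    using x qP k by (simp add: flag_def q_def k_def)
  have q_eq: "q = (mu / k) *\<^sub>R us + (lam / k) *\<^sub>R vs"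
    by (simp add: q_def ps(3) scaleR_add_right)
  have qu: "q \<bullet> u = 1 / k" "q \<bullet> v = 1 / k" "q \<bullet> x = 1"
    using ps k by (auto simp: q_def k_def)
  have dets: "det2 u x \<noteq> 0" "det2 x v \<noteq> 0" "det2 us q \<noteq> 0" "det2 q vs \<noteq> 0"
  proof -
    have "det2 u x = t * det2 u v" "det2 x v = s * det2 u v"
      "det2 us q = lam / k * det2 us vs" "det2 q vs = mu / k * det2 us vs"
      by (simp_all add: xst(1) q_eq det2_def algebra_simps)
    then show "det2 u x \<noteq> 0" "det2 x v \<noteq> 0" "det2 us q \<noteq> 0" "det2 q vs \<noteq> 0"
      using d st pos k by auto
  qed
  have tris: "tri u x = t * tri u v" "tri x v = s * tri u v"
    "tri us q = lam / k * tri us vs" "tri q vs = mu / k * tri us vs"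
    using st pos k unfolding xst(1) q_eq tri_combination_left tri_combination_right by auto
  define e1 where "e1 = D * \<alpha> / (D + \<alpha>)"
  define e2 where "e2 = D * \<beta> / (D + \<beta>)"
  have e: "0 \<le> e1" "0 \<le> e2"
    using D \<alpha> \<beta> by (auto simp: e1_def e2_def)
  have ux: "us \<bullet> x = 1 - \<alpha>" "vs \<bullet> x = 1 - \<beta>"
    by (auto simp: \<alpha>_def \<beta>_def)
  \<comment> \<open>The supporting line through x cuts the two given ones in the points p1 and p2 below.\<close>
  obtain h1 where h1: "1 \<le> h1" "h1 \<le> 1 + e1" "(1 + e1) / h1 * tri u x \<le> area (K \<inter> sector u x)"
    "h1 * tri us q \<le> area (polar K \<inter> sector us q)"
  proof -
    define p1 where "p1 = (k * \<alpha> / (D + \<alpha>)) *\<^sub>R u + (D / (D + \<alpha>)) *\<^sub>R x"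
    have "us \<bullet> p1 = (k * \<alpha> + D * (1 - \<alpha>)) / (D + \<alpha>)" "q \<bullet> p1 = (\<alpha> + D) / (D + \<alpha>)"
      using k by (auto simp: p1_def inner_add_right f(3) ux qu add_divide_distrib)
    then have "us \<bullet> p1 = 1" "q \<bullet> p1 = 1"
      using D \<alpha> by (auto simp: kD algebra_simps)
    moreover have "k * \<alpha> / (D + \<alpha>) + D / (D + \<alpha>) = 1 + e1"
    proof -
      have "k * \<alpha> + D = (D + \<alpha>) + D * \<alpha>"
        by (simp add: kD algebra_simps)
      then have "(k * \<alpha> + D) / (D + \<alpha>) = (D + \<alpha>) / (D + \<alpha>) + e1"
        by (simp only: e1_def add_divide_distrib[symmetric])
      then show ?thesis
        using D \<alpha> by (simp add: add_divide_distrib[symmetric])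
    qed
    ultimately show ?thesis
      using that D \<alpha> k
        sector_areas[OF K fl(1) flx dets(1,3), of p1 "k * \<alpha> / (D + \<alpha>)" "D / (D + \<alpha>)"]
      by (auto simp: p1_def)
  qed
  obtain h2 where h2: "1 \<le> h2" "h2 \<le> 1 + e2" "(1 + e2) / h2 * tri x v \<le> area (K \<inter> sector x v)"
    "h2 * tri q vs \<le> area (polar K \<inter> sector q vs)"
  proof -
    define p2 where "p2 = (D / (D + \<beta>)) *\<^sub>R x + (k * \<beta> / (D + \<beta>)) *\<^sub>R v"
    have "q \<bullet> p2 = D / (D + \<beta>) + \<beta> / (D + \<beta>)" "vs \<bullet> p2 = (D * (1 - \<beta>) + k * \<beta>) / (D + \<beta>)"
      using k by (auto simp: p2_def inner_add_right f(6) ux qu add_divide_distrib)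
    moreover have "D / (D + \<beta>) + \<beta> / (D + \<beta>) = 1"
      using D \<beta> by (simp add: add_divide_distrib[symmetric])
    ultimately have "q \<bullet> p2 = 1" "vs \<bullet> p2 = 1"
      using D \<beta> by (auto simp: kD algebra_simps)
    moreover have "D / (D + \<beta>) + k * \<beta> / (D + \<beta>) = 1 + e2"
    proof -
      have "D + k * \<beta> = (D + \<beta>) + D * \<beta>"
        by (simp add: kD algebra_simps)
      then have "(D + k * \<beta>) / (D + \<beta>) = (D + \<beta>) / (D + \<beta>) + e2"
        by (simp only: e2_def add_divide_distrib[symmetric])
      then show ?thesis
        using D \<beta> by (simp add: add_divide_distrib[symmetric])
    qed
    ultimately show ?thesis
      using that D \<beta> k
        sector_areas[OF K flx fl(2) dets(2,4), of p2 "D / (D + \<beta>)" "k * \<beta> / (D + \<beta>)"]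
      by (auto simp: p2_def)
  qed
  let ?A = "t * ((1 + e1) / h1) + s * ((1 + e2) / h2)" and ?B = "lam * h1 + mu * h2"
  have areaK: "?A * tri u v \<le> area (K \<inter> sector u v)"
  proof -
    have "?A * tri u v = (1 + e1) / h1 * tri u x + (1 + e2) / h2 * tri x v"
      by (simp add: tris algebra_simps)
    also have "\<dots> \<le> area (K \<inter> sector u x) + area (K \<inter> sector x v)"
      by (intro add_mono h1 h2)
    also have "\<dots> \<le> area (K \<inter> sector u v)"
      using K d st xst mem_sector[of s t u v] compact_imp_bounded
      by (intro area_sector_split) auto
    finally show ?thesis .
  qed
  have areaP: "?B / k * tri us vs \<le> area (polar K \<inter> sector us vs)"
  proof -
    have "?B / k * tri us vs = h1 * tri us q + h2 * tri q vs"
      by (simp add: tris algebra_simps add_divide_distrib)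
    also have "\<dots> \<le> area (polar K \<inter> sector us q) + area (polar K \<inter> sector q vs)"
      by (intro add_mono h1 h2)
    also have "\<dots> \<le> area (polar K \<inter> sector us vs)"
      using K d pos k mem_sector[of "mu / k" "lam / k" us vs] convex_polar bounded_polar
      by (intro area_sector_split) (auto simp: q_eq)
    finally show ?thesis .
  qed
  \<comment> \<open>The point p is a non-negative combination of x and v, on which y is at most 1.\<close>
  have gain: "(k - 1) * (y \<bullet> p - 1) / (lam + mu - 1) \<le> e2"
  proof -
    have "p = (lam / s) *\<^sub>R x + (mu - lam * t / s) *\<^sub>R v"
      using st by (simp add: p(3) xst(1) algebra_simps)
    then have "y \<bullet> p = (lam / s) * (y \<bullet> x) + (mu - lam * t / s) * (y \<bullet> v)"
      by (simp add: inner_add_right)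
    also have "\<dots> \<le> (lam / s) * 1 + (mu - lam * t / s) * 1"
      using st xst(2) pos polar_inner_le[OF y] x f
      by (intro add_mono mult_left_mono) (auto simp: field_simps)
    finally have "s * (y \<bullet> p - 1) \<le> lam - lam * t + s * (mu - 1)"
      using st by (simp add: field_simps)
    also have "\<dots> = lam * \<beta>"
      using s_eq unfolding D_eq by (simp add: algebra_simps)
    finally have "y \<bullet> p - 1 \<le> lam * \<beta> / s"
      using st by (simp add: field_simps)
    also have "s = lam * (D + \<beta>) / (lam + mu - 1)"
      using s_eq pos by (simp add: field_simps)
    finally have "y \<bullet> p - 1 \<le> \<beta> / (D + \<beta>) * (lam + mu - 1)"
      using pos by simp
    then have "(y \<bullet> p - 1) / (lam + mu - 1) \<le> \<beta> / (D + \<beta>)"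
      using pos by (simp add: pos_divide_le_eq)
    then have "D * ((y \<bullet> p - 1) / (lam + mu - 1)) \<le> D * (\<beta> / (D + \<beta>))"
      using D by (intro mult_left_mono) auto
    then show ?thesis
      by (simp add: e2_def D_def)
  qed
  have "k * (lam + mu + lam * mu / (lam + mu) * e2) \<le> ?A * ?B"
    unfolding kst using st pos e h1 h2 xst(2) by (intro glued_product_bound) auto
  then have "lam + mu + lam * mu / (lam + mu) * e2 \<le> ?A * ?B / k"
    using k by (simp add: pos_le_divide_eq mult.commute)
  moreover have "lam * mu / (lam + mu) * ((k - 1) * (y \<bullet> p - 1) / (lam + mu - 1))
      \<le> lam * mu / (lam + mu) * e2"
    using gain pos by (intro mult_left_mono) auto
  ultimately have "lam + mu + lam * mu / (lam + mu) * ((k - 1) * (y \<bullet> p - 1) / (lam + mu - 1))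
      \<le> ?A * ?B / k"
    by linarith
  then have "(lam + mu + lam * mu / (lam + mu) * ((k - 1) * (y \<bullet> p - 1) / (lam + mu - 1)))
      * (tri u v * tri us vs) \<le> (?A * ?B / k) * (tri u v * tri us vs)"
    by (rule mult_right_mono) simp
  also have "\<dots> = (?A * tri u v) * (?B / k * tri us vs)"
    by simp
  also have "\<dots> \<le> area (K \<inter> sector u v) * area (polar K \<inter> sector us vs)"
    using areaK areaP st pos h1 h2 e k by (intro mult_mono) auto
  finally show ?thesis
    by (simp add: k_def)
qed

text \<open>The flags (u, us) and (v, vs) enter symmetrically, so p may be assumed to lie on either side
  of the ray through x.\<close>

lemma refined_area_product:
  assumes K: "convex K" "compact K" "0 \<in> interior K"
    and fl: "flag K u us" "flag K v vs" and d: "det2 u v \<noteq> 0" "det2 us vs \<noteq> 0"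
    and p: "us \<bullet> p = 1" "vs \<bullet> p = 1" "p = lam *\<^sub>R u + mu *\<^sub>R v"
    and pos: "0 < lam" "0 < mu" "1 < lam + mu"
    and ps: "ps \<bullet> u = 1" "ps \<bullet> v = 1" "ps = mu *\<^sub>R us + lam *\<^sub>R vs"
    and x: "x \<in> K" "\<And>z. z \<in> K \<Longrightarrow> ps \<bullet> z \<le> ps \<bullet> x" "1 < ps \<bullet> x"
    and y: "y \<in> polar K"
  shows "(lam + mu + lam * mu / (lam + mu) * ((ps \<bullet> x - 1) * (y \<bullet> p - 1) / (lam + mu - 1)))
      * (tri u v * tri us vs)
    \<le> area (K \<inter> sector u v) * area (polar K \<inter> sector us vs)"
proof -
  obtain s t where xst: "x = s *\<^sub>R u + t *\<^sub>R v"
    using det2_coordinates[OF d(1)] by blast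
  show ?thesis
  proof (cases "lam * t \<le> mu * s")
    case True
    then show ?thesis
      using refined_area_product_oriented[OF K fl d p pos ps x y xst] by simp
  next
    case False
    have dd: "det2 v u \<noteq> 0" "det2 vs us \<noteq> 0"
      using d by (auto simp: det2_def mult.commute)
    have sums: "p = mu *\<^sub>R v + lam *\<^sub>R u" "ps = lam *\<^sub>R vs + mu *\<^sub>R us" "x = t *\<^sub>R v + s *\<^sub>R u"
      "1 < mu + lam" "mu * s \<le> lam * t"
      using p ps xst pos False by (simp_all add: add.commute)
    show ?thesis
      using refined_area_product_oriented[OF K fl(2,1) dd p(2,1) sums(1) pos(2,1) sums(4)
          ps(2,1) sums(2) x y sums(3) sums(5)]
      by (simp add: sector_commute[of v u] sector_commute[of vs us] insert_commute
          add.commute mult.commute)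
  qed
qed

section \<open>Stability\<close>

lemma dilated_triangle_eq:
  assumes "0 < c" "w \<bullet> u = 1" "w \<bullet> v = 1"
  shows "dilate c (convex hull {0, u, v}) = {x \<in> sector u v. w \<bullet> x \<le> c}"
proof (intro equalityI subsetI)
  fix x assume "x \<in> dilate c (convex hull {0, u, v})"
  then obtain s t where x: "x = c *\<^sub>R (s *\<^sub>R u + t *\<^sub>R v)" "0 \<le> s" "0 \<le> t" "s + t \<le> 1"
    by (auto simp: triangle_eq)
  have "w \<bullet> x = c * (s + t)"
    using assms by (simp add: x(1) inner_add_right)
  also have "\<dots> \<le> c * 1"
    using x assms by (intro mult_left_mono) auto
  finally show "x \<in> {x \<in> sector u v. w \<bullet> x \<le> c}"
    using x assms by (simp add: sector_scale mem_sector)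
next
  fix x assume "x \<in> {x \<in> sector u v. w \<bullet> x \<le> c}"
  then obtain s t where x: "x = s *\<^sub>R u + t *\<^sub>R v" "0 \<le> s" "0 \<le> t" "w \<bullet> x \<le> c"
    by (auto simp: sector_def)
  have "s + t \<le> c"
    using x assms by (simp add: inner_add_right)
  then have "(s / c) *\<^sub>R u + (t / c) *\<^sub>R v \<in> convex hull {0, u, v}"
    using x assms by (intro mem_triangle) (auto simp: field_simps)
  moreover have "x = c *\<^sub>R ((s / c) *\<^sub>R u + (t / c) *\<^sub>R v)"
    using x assms by (simp add: scaleR_add_right)
  ultimately show "x \<in> dilate c (convex hull {0, u, v})"
    by blast
qed

text \<open>Let L = lam + mu.  One of k and h is at least sqrt L, so that (k - 1) (h - 1) is at least
  gamma epsilon (sqrt L - 1) if both gaps are large.  With m the minimum of lam and mu, the factor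
  lam mu / L is at least m/2, and gamma is chosen such that m gamma (sqrt L - 1) = 3 L (L - 1); the
  gain is then at least (3/2) L epsilon, more than the hypothesis leaves.\<close>

lemma no_two_large_gaps:
  fixes lam mu k h \<epsilon> \<gamma> :: real
  assumes pos: "0 < lam" "0 < mu" "1 < lam + mu" "0 < \<epsilon>"
    and \<gamma>: "\<gamma> = 3 * ((lam + mu) / min lam mu) * (1 + sqrt (lam + mu))"
    and kh: "lam + mu \<le> k * h" "1 + \<gamma> * \<epsilon> < k" "1 + \<gamma> * \<epsilon> < h"
    and le: "lam + mu + lam * mu / (lam + mu) * ((k - 1) * (h - 1) / (lam + mu - 1))
      \<le> (1 + \<epsilon>) * (lam + mu)"
  shows False
proof -
  define L where "L = lam + mu"
  define m where "m = min lam mu"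
  define r where "r = sqrt L"
  have L: "1 < L" and m: "0 < m"
    using pos by (auto simp: L_def m_def)
  have r: "1 < r" "r * r = L"
    using L by (auto simp: r_def)
  have \<gamma>': "\<gamma> = 3 * (L / m) * (1 + r)"
    by (simp add: \<gamma> L_def m_def r_def)
  have g: "0 < \<gamma> * \<epsilon>"
  proof -
    note \<gamma>'
    also have "0 < \<dots>"
      using L m r by (intro mult_pos_pos divide_pos_pos) auto
    finally show ?thesis
      using pos by simp
  qed
  have "r \<le> k \<or> r \<le> h"
  proof (rule ccontr)
    assume "\<not> ?thesis"
    then have "k * h < r * r"
      using kh g by (intro mult_strict_mono) auto
    then show False
      using kh r by (simp add: L_def)
  qed
  then have gap: "\<gamma> * \<epsilon> * (r - 1) \<le> (k - 1) * (h - 1)"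
  proof
    assume "r \<le> k"
    then have "(r - 1) * (\<gamma> * \<epsilon>) \<le> (k - 1) * (h - 1)"
      using r kh g by (intro mult_mono) auto
    then show ?thesis
      by (simp add: mult_ac)
  next
    assume "r \<le> h"
    then show ?thesis
      using r kh g by (intro mult_mono) auto
  qed
  have half: "m / 2 \<le> lam * mu / L"
    using pos by (simp add: L_def m_def min_def field_simps)
  have "\<gamma> * m = 3 * L * (1 + r)"
    using m by (simp add: \<gamma>')
  then have "(\<gamma> * m) * \<epsilon> * (r - 1) = 3 * L * \<epsilon> * (r * r - 1)"
    by (simp add: algebra_simps)
  then have "m / 2 * (\<gamma> * \<epsilon> * (r - 1) / (L - 1)) = 3 / 2 * (L * \<epsilon>)"
    using L r by (simp add: field_simps)
  moreover have "m / 2 * (\<gamma> * \<epsilon> * (r - 1) / (L - 1))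
      \<le> lam * mu / L * ((k - 1) * (h - 1) / (L - 1))"
  proof -
    have "0 \<le> \<gamma> * \<epsilon> * (r - 1)"
      by (rule mult_nonneg_nonneg) (use g r in simp_all)
    then show ?thesis
      using L pos
      by (intro mult_mono divide_right_mono divide_nonneg_nonneg half gap) auto
  qed
  moreover have "lam * mu / L * ((k - 1) * (h - 1) / (L - 1)) \<le> L * \<epsilon>"
    using le by (simp add: L_def algebra_simps)
  ultimately have "3 / 2 * (L * \<epsilon>) \<le> L * \<epsilon>"
    by linarith
  then show False
    using mult_pos_pos[of L \<epsilon>] L pos by simp
qed

theorem lemma8:
  fixes K C Cs :: "(real^2) set"
    and u v us vs p ps :: "real^2"
    and \<epsilon> \<gamma> lam mu :: real
  assumes "convex_body K"
    and "0 \<in> interior K"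
    and "u \<in> frontier K" and "v \<in> frontier K" and "lin_indep2 u v"
    and "us \<in> frontier (polar K)" and "vs \<in> frontier (polar K)" and "lin_indep2 us vs"
    and "u \<in> K \<inter> supp_line K us"
    and "v \<in> K \<inter> supp_line K vs"
    and "supp_line K us \<inter> supp_line K vs = {p}"
    and "convex hull {p, 0} \<inter> convex hull {u, v} \<noteq> {}"
    and "us \<in> polar K \<inter> supp_line (polar K) u"
    and "vs \<in> polar K \<inter> supp_line (polar K) v"
    and "supp_line (polar K) u \<inter> supp_line (polar K) v = {ps}"
    and "convex hull {ps, 0} \<inter> convex hull {us, vs} \<noteq> {}"
    and "C = K \<inter> convex hull {0, u, v, p}"
    and "Cs = polar K \<inter> convex hull {0, us, vs, ps}"
    and "lam > 0" and "mu > 0" and "p = lam *\<^sub>R u + mu *\<^sub>R v"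
    and "\<epsilon> > 0" and "\<epsilon> < min lam mu / (lam + mu)"
    and "area C * area Cs
           \<le> (1 + \<epsilon>) * area (convex hull {0, u, v, p}) * area (convex hull {0, us, vs})"
    and "\<gamma> = 3 * ((lam + mu) / min lam mu) * (1 + sqrt (lam + mu))"
  shows "(C \<subseteq> dilate (1 + \<gamma> * \<epsilon>) (convex hull {0, u, v})
           \<or> dilate (inverse (1 + \<gamma> * \<epsilon>)) (convex hull {0, u, v, p}) \<subseteq> C)
         \<and> (dilate (inverse (1 + \<gamma> * \<epsilon>)) (convex hull {0, u, v, p}) \<subseteq> C
             \<longleftrightarrow> Cs \<subseteq> dilate (1 + \<gamma> * \<epsilon>) (convex hull {0, us, vs}))"
proof -
  have K: "convex K" "compact K" "0 \<in> interior K" and K0: "0 \<in> K" "closed K"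
    using assms(1,2) interior_subset compact_imp_closed by (auto simp: convex_body_def)
  note lam = assms(19) and mu = assms(20) and p = assms(21) and \<epsilon> = assms(22)
  have d: "det2 u v \<noteq> 0" "det2 us vs \<noteq> 0"
    using assms(5,8) lin_indep2_imp_det2 by auto
  have fl: "flag K u us" "flag K v vs"
    using flag_if_on_supp_line[OF K(2)] assms(6,7,9,10) by auto
  note f = flagD[OF fl(1)] flagD[OF fl(2)]
  have usp: "us \<bullet> p = 1" "vs \<bullet> p = 1"
  proof -
    have "p \<in> supp_line K us" "p \<in> supp_line K vs"
      using assms(11) by auto
    then have "us \<bullet> p = us \<bullet> u" "vs \<bullet> p = vs \<bullet> v"
      using assms(9,10) by (simp_all add: supp_line_def)
    then show "us \<bullet> p = 1" "vs \<bullet> p = 1"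
      using f by auto
  qed
  have ups: "ps \<bullet> u = 1" "ps \<bullet> v = 1"
  proof -
    have "ps \<in> supp_line (polar K) u" "ps \<in> supp_line (polar K) v"
      using assms(15) by auto
    then have "u \<bullet> ps = u \<bullet> us" "v \<bullet> ps = v \<bullet> vs"
      using assms(13,14) by (simp_all add: supp_line_def)
    then show "ps \<bullet> u = 1" "ps \<bullet> v = 1"
      using f by (auto simp: inner_commute)
  qed
  have le1: "us \<bullet> v \<le> 1" "vs \<bullet> u \<le> 1"
    using f polar_inner_le by auto
  have ab: "lam + mu * (us \<bullet> v) = 1" "lam * (vs \<bullet> u) + mu = 1"
    using p usp f by (auto simp: inner_add_right)
  \<comment> \<open>The coefficients of p and ps are the same numbers in opposite order.\<close>
  have ps: "ps = mu *\<^sub>R us + lam *\<^sub>R vs"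
    using ab f ups by (intro eq_if_inner_eq_basis[OF d(1)]) (auto simp: inner_add_left)
  have L: "1 < lam + mu"
  proof (rule ccontr)
    assume "\<not> 1 < lam + mu"
    then have "mu * 1 \<le> mu * (us \<bullet> v)" "lam * 1 \<le> lam * (vs \<bullet> u)"
      using ab by auto
    then have "us \<bullet> v = 1" "vs \<bullet> u = 1"
      using le1 lam mu by auto
    then have "us = vs"
      using f by (intro eq_if_inner_eq_basis[OF d(1)]) auto
    then show False
      using d by (simp add: det2_def)
  qed
  obtain x where x: "x \<in> K" "\<And>z. z \<in> K \<Longrightarrow> ps \<bullet> z \<le> ps \<bullet> x"
  proof -
    have "continuous_on K (\<lambda>z. ps \<bullet> z)"
      by (intro continuous_intros)
    then show ?thesis
      using that continuous_attains_sup[OF K(2)] K0 by (metis empty_iff)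
  qed
  obtain y where y: "y \<in> polar K" "\<And>z. z \<in> polar K \<Longrightarrow> z \<bullet> p \<le> y \<bullet> p"
  proof -
    have "continuous_on (polar K) (\<lambda>z. z \<bullet> p)"
      by (intro continuous_intros)
    then show ?thesis
      using that continuous_attains_sup[OF compact_polar[OF K(3)]] f(2) by (metis empty_iff)
  qed
  define c where "c = 1 + \<gamma> * \<epsilon>"
  have "0 \<le> \<gamma>"
    using lam mu unfolding assms(25) by (intro mult_nonneg_nonneg divide_nonneg_nonneg) auto
  then have c: "1 \<le> c"
    using \<epsilon> by (simp add: c_def)
  have C: "C = K \<inter> sector u v"
    unfolding assms(17)
    using quadrilateral_eq(1)[OF f(3,6) le1 usp p lam mu] f polar_inner_le by auto
  have Cs: "Cs = polar K \<inter> sector us vs"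
    unfolding assms(18)
    using quadrilateral_eq(1)[of u us v vs ps mu lam] f ps ups le1 lam mu polar_inner_le
    by (auto simp: inner_commute)

  have C_triangle: "C \<subseteq> dilate c (convex hull {0, u, v})" if "ps \<bullet> x \<le> c"
    using that x c ups by (force simp: C dilated_triangle_eq[of c ps])
  have C_quadrilateral: "dilate (inverse c) (convex hull {0, u, v, p}) \<subseteq> C \<longleftrightarrow> y \<bullet> p \<le> c"
  proof
    assume "dilate (inverse c) (convex hull {0, u, v, p}) \<subseteq> C"
    moreover have "p \<in> convex hull {0, u, v, p}"
      by (simp add: hull_inc)
    ultimately have "inverse c *\<^sub>R p \<in> K"
      by (auto simp: C)
    then have "y \<bullet> (inverse c *\<^sub>R p) \<le> 1"
      using y polar_inner_le by blast
    then show "y \<bullet> p \<le> c"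
      using c by (simp add: field_simps)
  next
    assume yc: "y \<bullet> p \<le> c"
    have scale: "inverse c *\<^sub>R z \<in> K" if "z \<in> K" for z
      using convexD[OF K(1) that K0(1), of "inverse c" "1 - inverse c"] c
      by (simp add: field_simps)
    have "inverse c *\<^sub>R p \<in> K"
      using scaled_mem_if_polar_bound[OF K(1) K0(2,1), of c p] y(2) yc c
      by (force simp: divide_inverse)
    then have "dilate (inverse c) {0, u, v, p} \<subseteq> C"
      using scale[OF K0(1)] scale[OF f(1)] scale[OF f(4)] c lam mu sector_generators
      by (auto simp: C p intro!: sector_scale mem_sector)
    moreover have "convex C"
      using K by (simp add: C convex_Int convex_sector)
    ultimately show "dilate (inverse c) (convex hull {0, u, v, p}) \<subseteq> C"
      unfolding convex_hull_scaling[symmetric] by (intro hull_minimal)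
  qed
  have Cs_triangle: "Cs \<subseteq> dilate c (convex hull {0, us, vs}) \<longleftrightarrow> y \<bullet> p \<le> c"
  proof
    assume "y \<bullet> p \<le> c"
    then show "Cs \<subseteq> dilate c (convex hull {0, us, vs})"
      using y c usp by (force simp: Cs dilated_triangle_eq[of c p] inner_commute)
  next
    assume sub: "Cs \<subseteq> dilate c (convex hull {0, us, vs})"
    show "y \<bullet> p \<le> c"
    proof (cases "y \<bullet> p \<le> 1")
      case False
      then have "y \<in> sector us vs"
        using f le1 d usp y polar_inner_le by (intro peak_in_sector[of us u vs v p]) auto
      then have "y \<in> dilate c (convex hull {0, us, vs})"
        using sub y by (auto simp: Cs)
      then show ?thesis
        using c usp by (simp add: dilated_triangle_eq[of c p] inner_commute)
    qed (use c in auto)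
  qed

  have "ps \<bullet> x \<le> c \<or> y \<bullet> p \<le> c"
  proof (rule ccontr)
    assume "\<not> ?thesis"
    then have kc: "1 + \<gamma> * \<epsilon> < ps \<bullet> x" "1 + \<gamma> * \<epsilon> < y \<bullet> p"
      by (auto simp: c_def)
    have k1: "1 < ps \<bullet> x" and h1: "1 < y \<bullet> p"
      using kc c by (auto simp: c_def)
    have "(1 / (y \<bullet> p)) *\<^sub>R p \<in> K"
      using scaled_mem_if_polar_bound[OF K(1) K0(2,1) _ y(2)] h1 by simp
    then have "ps \<bullet> ((1 / (y \<bullet> p)) *\<^sub>R p) \<le> ps \<bullet> x"
      using x by blast
    moreover have "ps \<bullet> p = lam + mu"
      using ups by (simp add: p inner_add_right)
    ultimately have kh: "lam + mu \<le> (ps \<bullet> x) * (y \<bullet> p)"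
      using h1 by (simp add: field_simps)
    have quad: "area (convex hull {0, u, v, p}) \<le> (lam + mu) * tri u v"
    proof -
      have "area (convex hull {0, u, v, p}) \<le> tri u p + tri p v"
        unfolding quadrilateral_eq(2)[OF f(3,6) le1 usp p lam mu]
        by (intro measure_Un_le fmeasurableD lmeasurable_compact)
          (simp_all add: finite_imp_compact_convex_hull)
      also have "\<dots> = (lam + mu) * tri u v"
        using lam mu unfolding p tri_combination_left tri_combination_right
        by (simp add: algebra_simps)
      finally show ?thesis .
    qed
    let ?T = "tri u v * tri us vs"
    have T: "0 < ?T"
      using d by (simp add: tri_eq_det2)
    have "(lam + mu + lam * mu / (lam + mu)
          * ((ps \<bullet> x - 1) * (y \<bullet> p - 1) / (lam + mu - 1))) * ?T \<le> area C * area Cs"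
      unfolding C Cs using refined_area_product[OF K fl d usp p lam mu L ups ps x k1 y(1)] .
    also have "\<dots> \<le> (1 + \<epsilon>) * area (convex hull {0, u, v, p}) * tri us vs"
      using assms(24) .
    also have "\<dots> \<le> (1 + \<epsilon>) * ((lam + mu) * tri u v) * tri us vs"
      using quad \<epsilon> by (intro mult_right_mono mult_left_mono) auto
    also have "\<dots> = ((1 + \<epsilon>) * (lam + mu)) * ?T"
      by simp
    finally have "lam + mu + lam * mu / (lam + mu)
        * ((ps \<bullet> x - 1) * (y \<bullet> p - 1) / (lam + mu - 1)) \<le> (1 + \<epsilon>) * (lam + mu)"
      using T mult_le_cancel_right_pos by blast
    then show False
      using no_two_large_gaps[OF lam mu L \<epsilon> assms(25) kh kc] by blast
  qed
  then show ?thesis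
    using C_triangle C_quadrilateral Cs_triangle unfolding c_def by blast
qed

end
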